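(* Let $Y$ and $X$ be topological spaces with $Y$ locally compact and Hausdorff, and let $\psi:Y\to X$ be a surjective local homeomorphism. Then the topological groupoid $R(\psi)$ is locally compact, Hausdorff, principal, étale and Cartan.
   Context: A neighbourhood of a point is a set containing an open set which contains the point. A topological space is locally compact if every point has a compact neighbourhood. A map $\psi$ is a local homeomorphism if every point of its domain has an open neighbourhood which $\psi$ maps homeomorphically onto an open subset of the codomain. $X$ is not assumed Hausdorff. For a surjection $\psi$ from a topological space $Y$ to a set $X$, let $R(\psi)=\{(y,z)\in Y\times Y:\psi(y)=\psi(z)\}$ with the subspace topology from $Y\times Y$ and the operations $r(y,z)=y$, $s(y,z)=z$, $(x,y)(y,z)=(x,z)$, $(y,z)^{-1}=(z,y)$. It is a topological groupoid with unit space $Y$ (identify $y$ with $(y,y)$). A groupoid $G$ with unit space $G^{(0)}$ and range and source maps $r,s$ is principal if there is at most one morphism between each pair of units. A topological groupoid is étale if $r$ (equivalently $s$) is a local homeomorphism (as a map into $G^{(0)}$). A topological groupoid $G$ is Cartan if every unit $u\in G^{(0)}$ has a neighbourhood $N$ in $G^{(0)}$ which is wandering, i.e. $s^{-1}(N)\cap r^{-1}(N)$ has compact closure in $G$. *)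

theory Defs
  imports "HOL-Analysis.Analysis"
begin

definition local_homeomorphism :: "'a topology \<Rightarrow> 'b topology \<Rightarrow> ('a \<Rightarrow> 'b) \<Rightarrow> bool" where
  "local_homeomorphism X Y f \<longleftrightarrow>
     (\<forall>x \<in> topspace X. \<exists>U. openin X U \<and> x \<in> U \<and> openin Y (f ` U) \<and>
        homeomorphic_map (subtopology X U) (subtopology Y (f ` U)) f)"

definition neighbourhood_in :: "'a topology \<Rightarrow> 'a \<Rightarrow> 'a set \<Rightarrow> bool" where
  "neighbourhood_in X x N \<longleftrightarrow> N \<subseteq> topspace X \<and> (\<exists>U. openin X U \<and> x \<in> U \<and> U \<subseteq> N)"

text \<open>
  A groupoid with topologies, presented with its unit space as a separate sort. The map
  \<open>unit_arr\<close> identifies a unit with its identity arrow; \<open>comp_arr g h\<close> is the product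
  \<open>gh\<close> and is meaningful only if \<open>src g = rng h\<close>.
\<close>

record ('g, 'u) groupoid_data =
  arr_top :: "'g topology"
  unit_top :: "'u topology"
  rng :: "'g \<Rightarrow> 'u"
  src :: "'g \<Rightarrow> 'u"
  unit_arr :: "'u \<Rightarrow> 'g"
  comp_arr :: "'g \<Rightarrow> 'g \<Rightarrow> 'g"
  inv_arr :: "'g \<Rightarrow> 'g"

abbreviation arrows :: "('g, 'u) groupoid_data \<Rightarrow> 'g set" where
  "arrows G \<equiv> topspace (arr_top G)"

abbreviation units :: "('g, 'u) groupoid_data \<Rightarrow> 'u set" where
  "units G \<equiv> topspace (unit_top G)"

definition composable :: "('g, 'u) groupoid_data \<Rightarrow> ('g \<times> 'g) set" where
  "composable G = {(g, h). g \<in> arrows G \<and> h \<in> arrows G \<and> src G g = rng G h}"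

definition groupoid :: "('g, 'u) groupoid_data \<Rightarrow> bool" where
  "groupoid G \<longleftrightarrow>
     (\<forall>g \<in> arrows G. rng G g \<in> units G \<and> src G g \<in> units G) \<and>
     (\<forall>u \<in> units G. unit_arr G u \<in> arrows G \<and>
        rng G (unit_arr G u) = u \<and> src G (unit_arr G u) = u) \<and>
     (\<forall>(g, h) \<in> composable G. comp_arr G g h \<in> arrows G \<and>
        rng G (comp_arr G g h) = rng G g \<and> src G (comp_arr G g h) = src G h) \<and>
     (\<forall>g h k. (g, h) \<in> composable G \<longrightarrow> (h, k) \<in> composable G \<longrightarrow>
        comp_arr G (comp_arr G g h) k = comp_arr G g (comp_arr G h k)) \<and>
     (\<forall>g \<in> arrows G. comp_arr G (unit_arr G (rng G g)) g = g \<and>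
        comp_arr G g (unit_arr G (src G g)) = g) \<and>
     (\<forall>g \<in> arrows G. inv_arr G g \<in> arrows G \<and>
        rng G (inv_arr G g) = src G g \<and> src G (inv_arr G g) = rng G g \<and>
        comp_arr G g (inv_arr G g) = unit_arr G (rng G g) \<and>
        comp_arr G (inv_arr G g) g = unit_arr G (src G g))"

text \<open>
  The unit space is a subspace of the groupoid: \<open>unit_arr\<close> is required to be an embedding.
\<close>

definition topological_groupoid :: "('g, 'u) groupoid_data \<Rightarrow> bool" where
  "topological_groupoid G \<longleftrightarrow>
     groupoid G \<and>
     embedding_map (unit_top G) (arr_top G) (unit_arr G) \<and>
     continuous_map (arr_top G) (unit_top G) (rng G) \<and>
     continuous_map (arr_top G) (unit_top G) (src G) \<and>
     continuous_map (subtopology (prod_topology (arr_top G) (arr_top G)) (composable G))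
       (arr_top G) (\<lambda>(g, h). comp_arr G g h) \<and>
     continuous_map (arr_top G) (arr_top G) (inv_arr G)"

definition principal_groupoid :: "('g, 'u) groupoid_data \<Rightarrow> bool" where
  "principal_groupoid G \<longleftrightarrow> groupoid G \<and>
     (\<forall>g \<in> arrows G. \<forall>h \<in> arrows G. rng G g = rng G h \<longrightarrow> src G g = src G h \<longrightarrow> g = h)"

definition etale_groupoid :: "('g, 'u) groupoid_data \<Rightarrow> bool" where
  "etale_groupoid G \<longleftrightarrow>
     topological_groupoid G \<and> local_homeomorphism (arr_top G) (unit_top G) (rng G)"

definition wandering :: "('g, 'u) groupoid_data \<Rightarrow> 'u set \<Rightarrow> bool" where
  "wandering G N \<longleftrightarrow>
     compactin (arr_top G)
       (arr_top G closure_of {g \<in> arrows G. src G g \<in> N \<and> rng G g \<in> N})"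

definition cartan_groupoid :: "('g, 'u) groupoid_data \<Rightarrow> bool" where
  "cartan_groupoid G \<longleftrightarrow> topological_groupoid G \<and>
     (\<forall>u \<in> units G. \<exists>N. neighbourhood_in (unit_top G) u N \<and> wandering G N)"

definition R_rel :: "'y topology \<Rightarrow> ('y \<Rightarrow> 'x) \<Rightarrow> ('y \<times> 'y) set" where
  "R_rel Y \<psi> = {(y, z) \<in> topspace Y \<times> topspace Y. \<psi> y = \<psi> z}"

definition R_groupoid :: "'y topology \<Rightarrow> ('y \<Rightarrow> 'x) \<Rightarrow> ('y \<times> 'y, 'y) groupoid_data" where
  "R_groupoid Y \<psi> =
     \<lparr> arr_top = subtopology (prod_topology Y Y) (R_rel Y \<psi>),
       unit_top = Y,
       rng = (\<lambda>(y, z). y),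
       src = (\<lambda>(y, z). z),
       unit_arr = (\<lambda>y. (y, y)),
       comp_arr = (\<lambda>(x, y) (y', z). (x, z)),
       inv_arr = (\<lambda>(y, z). (z, y)) \<rparr>"

end

theory Submission
  imports Defs
begin

text \<open>
  Everything rests on one local description. If \<open>\<psi>\<close> maps the open sets \<open>U\<close> and \<open>V\<close>
  homeomorphically onto open subsets of \<open>X\<close>, then the open part \<open>R(\<psi>) \<inter> (U \<times> V)\<close> of the groupoid
  is the graph of the continuous map \<open>(\<psi>|V)\<^sup>-\<^sup>1 \<circ> \<psi>\<close>, whose domain \<open>{y \<in> U. \<psi> y \<in> \<psi> V}\<close>
  is open in \<open>Y\<close>. A graph is homeomorphic to its domain under the first projection, so the range map
  is a local homeomorphism (\<open>local_homeomorphism_fst_R_rel\<close>) and \<open>R(\<psi>)\<close> is etale.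
  The Hausdorff property passes from \<open>Y\<close> to \<open>Y \<times> Y\<close> and to subspaces. Local compactness
  is pulled back along the range map (\<open>locally_compact_space_local_homeomorphism\<close>) and
  not inherited from \<open>Y \<times> Y\<close>, where \<open>R(\<psi>)\<close> may fail to be closed if \<open>X\<close> is not Hausdorff.

  For the Cartan property, put a compact neighbourhood \<open>K\<close> of a given unit inside an open set on
  which \<open>\<psi>\<close> is injective. The arrows with both ends in \<open>K\<close> are then just the units over \<open>K\<close>: they
  form a homeomorphic copy of \<open>K\<close>, which is compact, hence closed in the Hausdorff space \<open>R(\<psi>)\<close>, so
  \<open>K\<close> is wandering (\<open>wandering_R_groupoid\<close>).

  The structure maps of \<open>R(\<psi>)\<close> are continuous because they are built from the coordinate projections,
  and \<open>R(\<psi>)\<close> is principal because an arrow is the pair of its range and source.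
\<close>

section \<open>Local homeomorphisms\<close>

lemma local_homeomorphismE:
  assumes "local_homeomorphism X Y f" and "x \<in> topspace X"
  obtains U g where "openin X U" "x \<in> U" "openin Y (f ` U)"
    "continuous_map (subtopology X U) Y f"
    "continuous_map (subtopology Y (f ` U)) X g"
    "\<And>z. z \<in> U \<Longrightarrow> g (f z) = z"
proof -
  obtain U where U: "openin X U" "x \<in> U" "openin Y (f ` U)"
    and hom: "homeomorphic_map (subtopology X U) (subtopology Y (f ` U)) f"
    using assms unfolding local_homeomorphism_def by blast
  obtain g where g: "homeomorphic_maps (subtopology X U) (subtopology Y (f ` U)) f g"
    using hom homeomorphic_map_maps by blast
  have "g (f z) = z" if "z \<in> U" for z
    using g U(1) that openin_subset by (fastforce simp: homeomorphic_maps_def)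
  moreover have "continuous_map (subtopology X U) Y f" "continuous_map (subtopology Y (f ` U)) X g"
    using g by (auto simp: homeomorphic_maps_def continuous_map_in_subtopology)
  ultimately show thesis
    using that U by blast
qed

lemma locally_compact_space_local_homeomorphism:
  assumes f: "local_homeomorphism X Y f"
    and Y: "locally_compact_space Y" "Hausdorff_space Y"
  shows "locally_compact_space X"
  unfolding locally_compact_space_def
proof
  fix x assume "x \<in> topspace X"
  then obtain U where U: "openin X U" "x \<in> U" "openin Y (f ` U)"
    and hom: "homeomorphic_map (subtopology X U) (subtopology Y (f ` U)) f"
    using f unfolding local_homeomorphism_def by blast
  (* Compact neighbourhoods can be shrunk into an open subspace because a locally compact Hausdorff
     space is regular. *)
  have "locally_compact_space (subtopology Y (f ` U))"
    using Y U(3) locally_compact_space_open_subset by blast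
  then have "locally_compact_space (subtopology X U)"
    using hom homeomorphic_locally_compact_space homeomorphic_map_imp_homeomorphic_space by blast
  moreover have "x \<in> topspace (subtopology X U)"
    using U \<open>x \<in> topspace X\<close> by simp
  ultimately obtain V K where VK: "openin (subtopology X U) V" "compactin (subtopology X U) K"
    "x \<in> V" "V \<subseteq> K"
    unfolding locally_compact_space_def by blast
  show "\<exists>V K. openin X V \<and> compactin X K \<and> x \<in> V \<and> V \<subseteq> K"
    using VK openin_trans_full[OF VK(1) U(1)] by (auto simp: compactin_subtopology)
qed

section \<open>The groupoid of a map\<close>

lemma R_groupoid_simps [simp]:
  "arr_top (R_groupoid Y \<psi>) = subtopology (prod_topology Y Y) (R_rel Y \<psi>)"
  "unit_top (R_groupoid Y \<psi>) = Y"
  "rng (R_groupoid Y \<psi>) = fst"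
  "src (R_groupoid Y \<psi>) = snd"
  "unit_arr (R_groupoid Y \<psi>) = (\<lambda>y. (y, y))"
  "comp_arr (R_groupoid Y \<psi>) g h = (fst g, snd h)"
  "inv_arr (R_groupoid Y \<psi>) = (\<lambda>g. (snd g, fst g))"
  by (simp_all add: R_groupoid_def case_prod_beta fun_eq_iff)

lemma groupoid_R_groupoid: "groupoid (R_groupoid Y \<psi>)"
  by (auto simp: groupoid_def composable_def R_rel_def)

lemma topological_groupoid_R_groupoid: "topological_groupoid (R_groupoid Y \<psi>)"
proof -
  let ?R = "subtopology (prod_topology Y Y) (R_rel Y \<psi>)"
  let ?C = "subtopology (prod_topology ?R ?R) (composable (R_groupoid Y \<psi>))"
  have fst: "continuous_map ?R Y fst" and snd: "continuous_map ?R Y snd"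
    by (auto intro: continuous_map_from_subtopology continuous_map_fst continuous_map_snd)
  (* The units are the graph of the identity map of Y. *)
  have "homeomorphic_map Y (subtopology (prod_topology Y Y) ((\<lambda>y. (y, y)) ` topspace Y)) (\<lambda>y. (y, y))"
    using homeomorphic_maps_graph[of Y Y "\<lambda>y. y"] homeomorphic_map_maps by fastforce
  moreover have "R_rel Y \<psi> \<inter> (\<lambda>y. (y, y)) ` topspace Y = (\<lambda>y. (y, y)) ` topspace Y"
    by (auto simp: R_rel_def)
  ultimately have emb: "embedding_map Y ?R (\<lambda>y. (y, y))"
    by (simp add: embedding_map_def subtopology_subtopology)
  have "continuous_map ?C Y (fst \<circ> fst)" "continuous_map ?C Y (snd \<circ> snd)"
    by (rule continuous_map_compose[OF _ fst] continuous_map_compose[OF _ snd],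
        intro continuous_map_from_subtopology continuous_map_fst continuous_map_snd)+
  then have "continuous_map ?C ?R (\<lambda>p. (fst (fst p), snd (snd p)))"
    by (auto simp: continuous_map_in_subtopology continuous_map_paired comp_def
        composable_def R_rel_def)
  then have comp: "continuous_map ?C ?R (\<lambda>(g, h). (fst g, snd h))"
    by (simp add: case_prod_unfold)
  have inv: "continuous_map ?R ?R (\<lambda>g. (snd g, fst g))"
    using fst snd by (auto simp: continuous_map_in_subtopology continuous_map_paired R_rel_def)
  show ?thesis
    using fst snd emb comp inv groupoid_R_groupoid by (simp add: topological_groupoid_def)
qed

lemma principal_groupoid_R_groupoid: "principal_groupoid (R_groupoid Y \<psi>)"
  by (auto simp: principal_groupoid_def groupoid_R_groupoid)

lemma Hausdorff_space_R_rel: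
  assumes "Hausdorff_space Y"
  shows "Hausdorff_space (subtopology (prod_topology Y Y) (R_rel Y \<psi>))"
  using assms by (simp add: Hausdorff_space_prod_topology Hausdorff_space_subtopology)

section \<open>The range map and wandering sets\<close>

text \<open>
  Near an arrow \<open>(y, z)\<close> the source of an arrow is determined by its range: it is obtained by applying
  \<open>\<psi>\<close> and then the inverse branch of \<open>\<psi>\<close> at \<open>z\<close>.
\<close>

lemma local_homeomorphism_fst_R_rel:
  assumes \<psi>: "local_homeomorphism Y X \<psi>"
  shows "local_homeomorphism (subtopology (prod_topology Y Y) (R_rel Y \<psi>)) Y fst"
  unfolding local_homeomorphism_def
proof
  let ?R = "subtopology (prod_topology Y Y) (R_rel Y \<psi>)"
  fix p assume "p \<in> topspace ?R"
  then obtain y z where p: "p = (y, z)" "y \<in> topspace Y" "z \<in> topspace Y" "\<psi> y = \<psi> z"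
    by (auto simp: R_rel_def)
  obtain U where U: "openin Y U" "y \<in> U" "continuous_map (subtopology Y U) X \<psi>"
    using \<psi> p(2) by (rule local_homeomorphismE)
  obtain V g where V: "openin Y V" "z \<in> V" "openin X (\<psi> ` V)"
    "continuous_map (subtopology X (\<psi> ` V)) Y g" "\<And>v. v \<in> V \<Longrightarrow> g (\<psi> v) = v"
    using \<psi> p(3) by (rule local_homeomorphismE) blast
  define D where "D = {a \<in> U. \<psi> a \<in> \<psi> ` V}"
  define W where "W = R_rel Y \<psi> \<inter> U \<times> V"
  have UY: "U \<subseteq> topspace Y" and VY: "V \<subseteq> topspace Y"
    using U(1) V(1) openin_subset by auto
  have "openin (subtopology Y U) {a \<in> topspace (subtopology Y U). \<psi> a \<in> \<psi> ` V}"
    using U(3) V(3) by (rule openin_continuous_map_preimage)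
  moreover have "{a \<in> topspace (subtopology Y U). \<psi> a \<in> \<psi> ` V} = D"
    using UY by (auto simp: D_def)
  ultimately have D: "openin Y D"
    using U(1) openin_trans_full by metis
  have DY: "topspace (subtopology Y D) = D"
    using UY by (auto simp: D_def)
  have W: "W = (\<lambda>a. (a, g (\<psi> a))) ` D"
    using UY VY V(5) by (force simp: W_def D_def R_rel_def)
  have "continuous_map (subtopology Y D) (subtopology X (\<psi> ` V)) \<psi>"
    using continuous_map_from_subtopology_mono[OF U(3), of D] DY
    by (auto simp: continuous_map_in_subtopology D_def)
  then have "continuous_map (subtopology Y D) Y (\<lambda>a. g (\<psi> a))"
    using continuous_map_compose V(4) by (fastforce simp: comp_def)
  then have "homeomorphic_maps (subtopology Y D)
      (subtopology (prod_topology (subtopology Y D) Y) W) (\<lambda>a. (a, g (\<psi> a))) fst"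
    using homeomorphic_maps_graph[of "subtopology Y D" Y "\<lambda>a. g (\<psi> a)"] DY W by simp
  then have "homeomorphic_map (subtopology (prod_topology (subtopology Y D) Y) W)
      (subtopology Y D) fst"
    using homeomorphic_maps_sym homeomorphic_map_maps by blast
  moreover have "subtopology (prod_topology (subtopology Y D) Y) W = subtopology ?R W"
  proof -
    have "D \<times> topspace Y \<inter> W = W" "R_rel Y \<psi> \<inter> W = W"
      using VY by (auto simp: W_def D_def R_rel_def)
    then show ?thesis
      by (simp add: prod_topology_subtopology subtopology_subtopology)
  qed
  moreover have "fst ` W = D"
    using W by force
  moreover have "openin ?R W"
    unfolding W_def using U(1) V(1)
    by (intro openin_subtopology_Int2) (simp add: openin_prod_Times_iff)
  moreover have "p \<in> W"
    using p U(2) V(2) by (auto simp: W_def R_rel_def)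
  ultimately show "\<exists>W. openin ?R W \<and> p \<in> W \<and> openin Y (fst ` W) \<and>
      homeomorphic_map (subtopology ?R W) (subtopology Y (fst ` W)) fst"
    using D by auto
qed

text \<open>
  Over a set on which \<open>\<psi>\<close> is injective the only arrows are units, so the arrows over \<open>K\<close> are the image of
  \<open>K\<close> under the diagonal map.
\<close>

lemma wandering_R_groupoid:
  assumes Y: "Hausdorff_space Y" and K: "compactin Y K" and inj: "inj_on \<psi> K"
  shows "wandering (R_groupoid Y \<psi>) K"
proof -
  let ?R = "subtopology (prod_topology Y Y) (R_rel Y \<psi>)"
  have KY: "K \<subseteq> topspace Y"
    using K compactin_subset_topspace by blast
  have "continuous_map Y ?R (\<lambda>y. (y, y))"
    by (auto simp: continuous_map_in_subtopology continuous_map_paired R_rel_def)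
  then have cpt: "compactin ?R ((\<lambda>y. (y, y)) ` K)"
    using K image_compactin by blast
  then have "?R closure_of ((\<lambda>y. (y, y)) ` K) = (\<lambda>y. (y, y)) ` K"
    using Hausdorff_space_R_rel[OF Y] compactin_imp_closedin closure_of_closedin by blast
  moreover have "{g \<in> topspace ?R. snd g \<in> K \<and> fst g \<in> K} = (\<lambda>y. (y, y)) ` K"
    using KY inj by (auto simp: R_rel_def dest: inj_onD)
  ultimately show ?thesis
    using cpt by (simp only: wandering_def R_groupoid_simps)
qed

lemma cartan_groupoid_R_groupoid:
  assumes Y: "locally_compact_space Y" "Hausdorff_space Y" and \<psi>: "local_homeomorphism Y X \<psi>"
  shows "cartan_groupoid (R_groupoid Y \<psi>)"
proof -
  have "\<exists>N. neighbourhood_in Y u N \<and> wandering (R_groupoid Y \<psi>) N" if "u \<in> topspace Y" for u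
  proof -
    obtain U g where U: "openin Y U" "u \<in> U" "\<And>z. z \<in> U \<Longrightarrow> g (\<psi> z) = z"
      using \<psi> \<open>u \<in> topspace Y\<close> by (rule local_homeomorphismE) blast
    obtain V K where VK: "openin Y V" "compactin Y K" "u \<in> V" "V \<subseteq> K" "K \<subseteq> U"
      using U(1,2) Y locally_compact_space_neighbourhood_base[of Y]
      unfolding neighbourhood_base_of by blast
    have "inj_on \<psi> K"
      using U(3) VK(5) by (intro inj_on_inverseI[of _ g]) blast
    then have "wandering (R_groupoid Y \<psi>) K"
      using Y(2) VK(2) by (intro wandering_R_groupoid)
    moreover have "neighbourhood_in Y u K"
      using VK compactin_subset_topspace unfolding neighbourhood_in_def by blast
    ultimately show ?thesis
      by blast
  qed
  then show ?thesis
    by (simp add: cartan_groupoid_def topological_groupoid_R_groupoid)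
qed

theorem proposition4p3:
  fixes Y :: "'y topology" and X :: "'x topology" and \<psi> :: "'y \<Rightarrow> 'x"
  assumes "locally_compact_space Y"
    and "Hausdorff_space Y"
    and "local_homeomorphism Y X \<psi>"
    and "\<psi> ` topspace Y = topspace X"
  shows "topological_groupoid (R_groupoid Y \<psi>)
    \<and> locally_compact_space (arr_top (R_groupoid Y \<psi>))
    \<and> Hausdorff_space (arr_top (R_groupoid Y \<psi>))
    \<and> principal_groupoid (R_groupoid Y \<psi>)
    \<and> etale_groupoid (R_groupoid Y \<psi>)
    \<and> cartan_groupoid (R_groupoid Y \<psi>)"
proof -
  have range: "local_homeomorphism (arr_top (R_groupoid Y \<psi>)) Y fst"
    using local_homeomorphism_fst_R_rel[OF assms(3)] by simp
  have "etale_groupoid (R_groupoid Y \<psi>)"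
    using range topological_groupoid_R_groupoid by (simp add: etale_groupoid_def)
  moreover have "locally_compact_space (arr_top (R_groupoid Y \<psi>))"
    using locally_compact_space_local_homeomorphism[OF range assms(1,2)] .
  moreover have "Hausdorff_space (arr_top (R_groupoid Y \<psi>))"
    using Hausdorff_space_R_rel[OF assms(2)] by simp
  ultimately show ?thesis
    using topological_groupoid_R_groupoid principal_groupoid_R_groupoid
      cartan_groupoid_R_groupoid[OF assms(1-3)] by blast
qed

end
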